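(* Let $1<\alpha<2$ and let $n\ge 2$ be an integer. Then the function $\lambda\mapsto E_{-\lambda,\alpha,0}(n,0)+\lambda E_{-\lambda,\alpha,\alpha-1}(n,0)$ has no real zeros $\lambda$ with $$|\lambda|<\frac{\Gamma(\alpha)}{(n-1)\,(n-1)^{\overline{\alpha-1}}}.$$
   Context: The generalized rising function is $t^{\overline{r}}=\Gamma(t+r)/\Gamma(t)$ for $t,t+r\in\mathbb{R}\setminus\{0,-1,-2,\dots\}$, and $0^{\overline r}:=0$. For $|p|<1$, $\alpha>0$ and $\beta\in\mathbb{R}$, the nabla Mittag-Leffler function is $$E_{p,\alpha,\beta}(t,a)=\sum_{k=0}^{\infty}p^{k}\frac{(t-a)^{\overline{\alpha k+\beta}}}{\Gamma(\alpha k+\beta+1)},\qquad t\in\{a,a+1,a+2,\dots\}.$$ *)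

theory Defs
  imports "HOL-Analysis.Analysis"
begin

(* The mathematical domain is t = 0, or both t and t + r outside {0,-1,-2,...}.
   The value 0 at t = 0 holds for every r, including r = 0.
   Elsewhere the value is a junk value coming from Gamma = 0 at the poles. *)
definition rising :: "real \<Rightarrow> real \<Rightarrow> real" where
  "rising t r = (if t = 0 then 0 else Gamma (t + r) / Gamma t)"

(* Arguments in the order p, alpha, beta, t, a.  Meaningful for \<bar>p\<bar> < 1, \<alpha> > 0
   and t - a a natural number, where the series converges absolutely. *)
definition nabla_ML :: "real \<Rightarrow> real \<Rightarrow> real \<Rightarrow> real \<Rightarrow> real \<Rightarrow> real" where
  "nabla_ML p \<alpha> \<beta> t a =
     (\<Sum>k::nat. p ^ k * (rising (t - a) (\<alpha> * real k + \<beta>) / Gamma (\<alpha> * real k + \<beta> + 1)))"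

end

theory Submission
  imports Defs
begin

text \<open>
  With \<open>n = m + 2\<close> and \<open>x = \<alpha> k\<close>, the \<open>k\<close>-th coefficients of the two series are
  \<open>(x+1)\<dots>(x+m+1) / (m+1)!\<close> and, after the shift caused by the factor \<open>\<lambda>\<close>,
  \<open>x(x+1)\<dots>(x+m) / (m+1)!\<close>. Their difference is \<open>a\<^sub>k = (x+1)\<dots>(x+m) / m!\<close>, so the
  function is \<open>\<Sum>\<^sub>k (-\<lambda>)\<^sup>k a\<^sub>k\<close>. The ratios \<open>a\<^bsub>k+1\<^esub> / a\<^sub>k\<close> are largest at \<open>k = 0\<close>, and the bound
  on \<open>\<lambda>\<close> gives \<open>\<bar>\<lambda>\<bar> a\<^sub>1 < a\<^sub>0 = 1\<close>. Hence the sum is positive: termwise for \<open>\<lambda> \<le> 0\<close>, and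
  by the Leibniz criterion for \<open>\<lambda> > 0\<close>.
\<close>

text \<open>This is the generalised binomial coefficient of \<alpha>k + m over m.\<close>

definition ml_coeff :: "real \<Rightarrow> nat \<Rightarrow> nat \<Rightarrow> real" where
  "ml_coeff \<alpha> m k = pochhammer (\<alpha> * real k + 1) m / fact m"

lemma ml_coeff_pos: "0 < \<alpha> \<Longrightarrow> 0 < ml_coeff \<alpha> m k"
  unfolding ml_coeff_def by (intro divide_pos_pos pochhammer_pos add_nonneg_pos) auto

lemma ml_coeff_0 [simp]: "ml_coeff \<alpha> m 0 = 1"
  by (simp add: ml_coeff_def pochhammer_fact [symmetric])

text \<open>Compare the products factor by factor: (a + 1 + j)(x + 1 + j) exceeds (x + a + 1 + j)(1
  + j) by exactly ax \<ge> 0.\<close>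

lemma pochhammer_shift_ratio_le:
  fixes x a :: real
  assumes "0 \<le> x" "0 \<le> a"
  shows "pochhammer (x + a + 1) m * pochhammer 1 m \<le> pochhammer (a + 1) m * pochhammer (x + 1) m"
proof (induction m)
  case (Suc m)
  have "(x + a + 1 + real m) * (1 + real m) \<le> (a + 1 + real m) * (x + 1 + real m)"
    using mult_nonneg_nonneg [OF assms] by (simp add: algebra_simps)
  moreover have "0 \<le> pochhammer (a + 1) m * pochhammer (x + 1) m"
    using assms by (intro mult_nonneg_nonneg pochhammer_nonneg) auto
  ultimately have "(pochhammer (x + a + 1) m * pochhammer 1 m) * ((x + a + 1 + real m) * (1 + real m))
      \<le> (pochhammer (a + 1) m * pochhammer (x + 1) m) * ((a + 1 + real m) * (x + 1 + real m))"
    using assms by (intro mult_mono [OF Suc.IH]) auto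
  then show ?case by (simp add: pochhammer_rec' mult_ac)
qed simp

text \<open>As the coefficient at 0 is 1, this bounds every ratio of successive coefficients by the
  first one. It yields both geometric domination and the monotonicity in the Leibniz
  criterion.\<close>

lemma ml_coeff_Suc_le:
  assumes "0 < \<alpha>"
  shows "ml_coeff \<alpha> m (Suc k) \<le> ml_coeff \<alpha> m 1 * ml_coeff \<alpha> m k"
proof -
  have "pochhammer (\<alpha> * real k + \<alpha> + 1) m * fact m
      \<le> pochhammer (\<alpha> + 1) m * pochhammer (\<alpha> * real k + 1) m"
    using pochhammer_shift_ratio_le [of "\<alpha> * real k" \<alpha> m] assms
    by (simp add: pochhammer_fact [symmetric])
  then show ?thesis
    by (simp add: ml_coeff_def field_simps)
qed

text \<open>Since (n + 1) + (r - 1) = r + n, the quotient of Gamma values telescopes. Both series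
  are covered: r = \<alpha>k + 1 for the first, r = \<alpha>(k + 1) for the second.\<close>

lemma rising_eq_pochhammer:
  fixes n :: nat and r :: real
  assumes "0 < r"
  shows "rising (real (Suc n)) (r - 1) / Gamma r = pochhammer r n / fact n"
proof -
  have "pochhammer r n = Gamma (r + real n) / Gamma r"
    using assms by (intro pochhammer_Gamma) (auto elim!: nonpos_Ints_cases)
  moreover have "Gamma (real (Suc n)) = fact n"
    by (metis Gamma_fact of_nat_Suc)
  ultimately show ?thesis
    by (simp add: rising_def add_ac)
qed

lemma nabla_ML_0:
  assumes "0 < \<alpha>"
  shows "nabla_ML p \<alpha> 0 (real (Suc m)) 0 = (\<Sum>k. p ^ k * ml_coeff \<alpha> m k)"
proof -
  have "0 < \<alpha> * real k + 1" for k
    using assms by (intro add_nonneg_pos) auto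
  then show ?thesis
    using rising_eq_pochhammer [of "\<alpha> * real k + 1" m for k]
    by (simp add: nabla_ML_def ml_coeff_def del: of_nat_Suc)
qed

lemma nabla_ML_alpha_minus_1:
  assumes "0 < \<alpha>"
  shows "nabla_ML p \<alpha> (\<alpha> - 1) (real (Suc m)) 0
    = (\<Sum>k. p ^ k * (pochhammer (\<alpha> * real (Suc k)) m / fact m))"
proof -
  have "rising (real (Suc m)) (\<alpha> * real k + (\<alpha> - 1)) / Gamma (\<alpha> * real k + (\<alpha> - 1) + 1)
      = pochhammer (\<alpha> * real (Suc k)) m / fact m" for k
  proof -
    have "\<alpha> * real k + (\<alpha> - 1) = \<alpha> * real (Suc k) - 1"
      and "\<alpha> * real k + (\<alpha> - 1) + 1 = \<alpha> * real (Suc k)"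
      by (simp_all add: algebra_simps)
    moreover have "0 < \<alpha> * real (Suc k)"
      using assms by (intro mult_pos_pos) auto
    ultimately show ?thesis
      using rising_eq_pochhammer by (simp only:)
  qed
  then show ?thesis
    by (simp add: nabla_ML_def del: of_nat_Suc)
qed

lemma ml_coeff_power_le:
  assumes "0 < \<alpha>"
  shows "\<bar>p\<bar> ^ k * ml_coeff \<alpha> m k \<le> (\<bar>p\<bar> * ml_coeff \<alpha> m 1) ^ k"
proof (induction k)
  case (Suc k)
  have "\<bar>p\<bar> ^ Suc k * ml_coeff \<alpha> m (Suc k) \<le> \<bar>p\<bar> ^ Suc k * (ml_coeff \<alpha> m 1 * ml_coeff \<alpha> m k)"
    using ml_coeff_Suc_le [OF assms] by (intro mult_left_mono) auto
  also have "\<dots> = (\<bar>p\<bar> * ml_coeff \<alpha> m 1) * (\<bar>p\<bar> ^ k * ml_coeff \<alpha> m k)"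
    by (simp add: mult_ac)
  also have "\<dots> \<le> (\<bar>p\<bar> * ml_coeff \<alpha> m 1) * (\<bar>p\<bar> * ml_coeff \<alpha> m 1) ^ k"
    using Suc ml_coeff_pos [OF assms, of m 1] by (intro mult_left_mono) auto
  finally show ?case by simp
qed simp

lemma ml_coeff_Suc_eq:
  "ml_coeff \<alpha> (Suc m) k = (\<alpha> * real k / (real m + 1) + 1) * ml_coeff \<alpha> m k"
proof -
  have "pochhammer (\<alpha> * real k + 1) (Suc m) = (\<alpha> * real k + 1 + real m) * pochhammer (\<alpha> * real k + 1) m"
    by (simp add: pochhammer_rec')
  then show ?thesis
    by (simp add: ml_coeff_def field_simps)
qed

text \<open>With x = \<alpha>k, both terms are multiples of \<open>ml_coeff \<alpha> m k\<close>, by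
  x/(m + 1) + 1 and by x/(m + 1).\<close>

lemma ml_coeff_diff:
  "ml_coeff \<alpha> (Suc m) k - pochhammer (\<alpha> * real k) (Suc m) / fact (Suc m) = ml_coeff \<alpha> m k"
proof -
  have "pochhammer (\<alpha> * real k) (Suc m) / fact (Suc m) = \<alpha> * real k / (real m + 1) * ml_coeff \<alpha> m k"
    by (simp add: ml_coeff_def pochhammer_rec field_simps)
  then show ?thesis
    by (simp add: ml_coeff_Suc_eq algebra_simps)
qed

lemma summable_ml_coeff:
  assumes "0 < \<alpha>" and q: "\<bar>p\<bar> * ml_coeff \<alpha> m 1 < 1"
  shows "summable (\<lambda>k. p ^ k * ml_coeff \<alpha> m k)"
    and "summable (\<lambda>k. p ^ k * ml_coeff \<alpha> (Suc m) k)"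
proof -
  define q where "q = \<bar>p\<bar> * ml_coeff \<alpha> m 1"
  have q01: "0 \<le> q" "q < 1"
    using assms ml_coeff_pos [OF assms(1), of m 1] by (auto simp: q_def)
  have bound: "\<bar>p ^ k * ml_coeff \<alpha> m k\<bar> \<le> q ^ k" for k
    using ml_coeff_power_le [OF assms(1), of p k m] ml_coeff_pos [OF assms(1), of m k]
    by (simp add: abs_mult power_abs q_def)
  have geo: "summable (\<lambda>k. q ^ k)"
    using q01 by (intro summable_geometric) auto
  then show "summable (\<lambda>k. p ^ k * ml_coeff \<alpha> m k)"
    by (rule summable_comparison_test') (use bound in simp)
  \<comment> \<open>Raising m by one costs a factor linear in k, so the majorant is a multiple of
    the differentiated geometric series.\<close>
  have "summable (\<lambda>k. real (Suc k) * q ^ k)"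
    using q01 geometric_deriv_sums [of q] by (auto simp: sums_iff)
  then have "summable (\<lambda>k. (\<alpha> + 1) * (real (Suc k) * q ^ k))"
    by (rule summable_mult)
  then show "summable (\<lambda>k. p ^ k * ml_coeff \<alpha> (Suc m) k)"
  proof (rule summable_comparison_test')
    fix k :: nat
    have "\<alpha> * real k / (real m + 1) \<le> \<alpha> * real k / 1"
      using assms(1) by (intro divide_left_mono) auto
    then have "\<alpha> * real k / (real m + 1) + 1 \<le> (\<alpha> + 1) * real (Suc k)"
      using assms(1) by (simp add: algebra_simps)
    moreover have "0 \<le> \<alpha> * real k / (real m + 1) + 1"
      using assms(1) by (intro add_nonneg_nonneg divide_nonneg_nonneg) auto
    ultimately have "\<bar>\<alpha> * real k / (real m + 1) + 1\<bar> * \<bar>p ^ k * ml_coeff \<alpha> m k\<bar>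
        \<le> ((\<alpha> + 1) * real (Suc k)) * q ^ k"
      using bound [of k] by (intro mult_mono) auto
    then show "norm (p ^ k * ml_coeff \<alpha> (Suc m) k) \<le> (\<alpha> + 1) * (real (Suc k) * q ^ k)"
      by (simp only: ml_coeff_Suc_eq real_norm_def abs_mult mult_ac)
  qed
qed

text \<open>The factor \<open>lam\<close> = -p raises the power in the second series by one, turning
  it into minus the sum of p^k B(k) over k \<ge> 1. As B(0) = 0, the index 0 may be included, and
  the series subtract termwise.\<close>

lemma nabla_ML_combination:
  assumes "0 < \<alpha>" and "\<bar>lam\<bar> * ml_coeff \<alpha> m 1 < 1"
  shows "nabla_ML (- lam) \<alpha> 0 (real (m + 2)) 0 + lam * nabla_ML (- lam) \<alpha> (\<alpha> - 1) (real (m + 2)) 0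
    = (\<Sum>k. (- lam) ^ k * ml_coeff \<alpha> m k)"
\<comment> \<open>Summability of the shifted series is obtained by cancelling a factor p, so p = 0
  is treated apart; there only the constant term 1 survives.\<close>
proof (cases "lam = 0")
  case True
  then show ?thesis
    using nabla_ML_0 [OF assms(1), of 0 "Suc m"] powser_zero [of "ml_coeff \<alpha> m"]
      powser_zero [of "ml_coeff \<alpha> (Suc m)"]
    by (simp add: mult.commute del: of_nat_Suc)
next
  case False
  define p where "p = - lam"
  define B where "B k = pochhammer (\<alpha> * real k) (Suc m) / fact (Suc m)" for k
  have "\<bar>p\<bar> * ml_coeff \<alpha> m 1 < 1" using assms(2) by (simp add: p_def)
  note sm = summable_ml_coeff [OF assms(1) this]
  have B: "p ^ k * B k = p ^ k * ml_coeff \<alpha> (Suc m) k - p ^ k * ml_coeff \<alpha> m k" for k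
  proof -
    have "B k = ml_coeff \<alpha> (Suc m) k - ml_coeff \<alpha> m k"
      using ml_coeff_diff [of \<alpha> m k] unfolding B_def by linarith
    then show ?thesis by (simp only: right_diff_distrib)
  qed
  have smB: "summable (\<lambda>k. p ^ k * B k)"
    unfolding B by (intro summable_diff sm)
  have B0: "B 0 = 0" by (simp add: B_def pochhammer_rec)
  have shift: "summable (\<lambda>k. p * (p ^ k * B (Suc k)))"
    using smB by (subst (asm) summable_Suc_iff [symmetric]) (simp add: mult_ac)
  have "summable (\<lambda>k. p ^ k * B (Suc k))"
    using shift False by (subst (asm) summable_cmult_iff) (simp add: p_def)
  then have "p * (\<Sum>k. p ^ k * B (Suc k)) = (\<Sum>k. p ^ Suc k * B (Suc k))"
    by (simp add: suminf_mult [symmetric] mult_ac)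
  also have "\<dots> = (\<Sum>k. p ^ k * B k)"
    using suminf_split_head [OF smB] B0 by simp
  also have "\<dots> = (\<Sum>k. p ^ k * ml_coeff \<alpha> (Suc m) k) - (\<Sum>k. p ^ k * ml_coeff \<alpha> m k)"
    unfolding B by (rule suminf_diff [symmetric]) (rule sm)+
  finally show ?thesis
    using nabla_ML_0 [OF assms(1), of p "Suc m"] nabla_ML_alpha_minus_1 [OF assms(1), of p "Suc m"]
    by (simp add: p_def B_def del: of_nat_Suc)
qed

lemma suminf_ml_coeff_pos:
  assumes "0 < \<alpha>" and "\<bar>p\<bar> * ml_coeff \<alpha> m 1 < 1"
  shows "0 < (\<Sum>k. p ^ k * ml_coeff \<alpha> m k)"
proof (cases "0 \<le> p")
  case True
  have "(\<Sum>k<1. p ^ k * ml_coeff \<alpha> m k) \<le> (\<Sum>k. p ^ k * ml_coeff \<alpha> m k)"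
    using True ml_coeff_pos [OF assms(1), THEN less_imp_le]
    by (intro sum_le_suminf summable_ml_coeff(1) assms) auto
  then show ?thesis by simp
next
  case False
  define c where "c k = (- p) ^ k * ml_coeff \<alpha> m k" for k
  have c_nonneg: "0 \<le> c k" for k
    using False ml_coeff_pos [OF assms(1), of m k] by (simp add: c_def)
  have sgn: "(- 1) ^ k * c k = p ^ k * ml_coeff \<alpha> m k" for k
    using power_mult_distrib [of "- 1" "- p" k] by (simp add: c_def)
  have "summable c"
    unfolding c_def using assms by (intro summable_ml_coeff(1)) auto
  then have lim: "c \<longlonglongrightarrow> 0" by (rule summable_LIMSEQ_zero)
  have mono: "c (Suc k) \<le> c k" for k
  proof -
    have "c (Suc k) \<le> (- p) ^ Suc k * (ml_coeff \<alpha> m 1 * ml_coeff \<alpha> m k)"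
      unfolding c_def using False by (intro mult_left_mono ml_coeff_Suc_le assms zero_le_power) simp
    also have "\<dots> = (\<bar>p\<bar> * ml_coeff \<alpha> m 1) * c k"
      using False by (simp add: c_def mult_ac)
    also have "\<dots> \<le> 1 * c k"
      using assms(2) c_nonneg by (intro mult_right_mono) auto
    finally show ?thesis by simp
  qed
  \<comment> \<open>This difference is 1 - \<bar>p\<bar> \<open>ml_coeff \<alpha> m 1\<close>; an
    even partial sum of an alternating series bounds its limit from below.\<close>
  have "0 < c 0 - c 1"
    using assms(2) False by (simp add: c_def)
  also have "\<dots> = (\<Sum>k<2 * 1. (- 1) ^ k * c k)"
    by (simp add: numeral_2_eq_2)
  also have "\<dots> \<le> (\<Sum>k. (- 1) ^ k * c k)"
    by (rule summable_Leibniz'(2) [OF lim c_nonneg mono])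
  finally show ?thesis unfolding sgn .
qed

text \<open>After cancelling Gamma and the factorials, the product equals (\<alpha> + m) /
  (\<alpha>(m + 1)), which is at most 1 because \<alpha> \<ge> 1.\<close>

lemma bound_mult_ml_coeff_1_le:
  assumes "1 < \<alpha>"
  shows "Gamma \<alpha> / (real (Suc m) * rising (real (Suc m)) (\<alpha> - 1)) * ml_coeff \<alpha> m 1 \<le> 1"
proof -
  have pos: "0 < pochhammer \<alpha> m" "0 < Gamma \<alpha>"
    using assms by (auto intro: pochhammer_pos)
  have "rising (real (Suc m)) (\<alpha> - 1) = Gamma \<alpha> * (pochhammer \<alpha> m / fact m)"
    using rising_eq_pochhammer [of \<alpha> m] assms pos by (simp add: field_simps)
  moreover have "ml_coeff \<alpha> m 1 = pochhammer (\<alpha> + 1) m / fact m"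
    by (simp add: ml_coeff_def)
  ultimately have "Gamma \<alpha> / (real (Suc m) * rising (real (Suc m)) (\<alpha> - 1)) * ml_coeff \<alpha> m 1
      = pochhammer (\<alpha> + 1) m / (real (Suc m) * pochhammer \<alpha> m)"
    using pos by (simp del: of_nat_Suc One_nat_def)
  also have "\<dots> \<le> 1"
  proof -
    \<comment> \<open>Both sides are \<open>pochhammer \<alpha> (Suc m)\<close>, split at its first
      and at its last factor.\<close>
    have "\<alpha> * pochhammer (\<alpha> + 1) m = (\<alpha> + real m) * pochhammer \<alpha> m"
      by (metis pochhammer_rec pochhammer_rec')
    also have "\<dots> \<le> (\<alpha> * real (Suc m)) * pochhammer \<alpha> m"
      using assms pos mult_right_mono [of 1 \<alpha> "real m"]
      by (intro mult_right_mono) (auto simp: algebra_simps)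
    finally have "pochhammer (\<alpha> + 1) m \<le> real (Suc m) * pochhammer \<alpha> m"
      using assms by (simp add: mult.assoc del: of_nat_Suc)
    then show ?thesis using pos by (simp add: divide_le_eq_1 del: of_nat_Suc)
  qed
  finally show ?thesis .
qed

theorem theorem4p8:
  fixes \<alpha> :: real and n :: nat
  assumes "1 < \<alpha>" and "\<alpha> < 2" and "2 \<le> n"
  shows "\<not> (\<exists>lam::real.
           \<bar>lam\<bar> < Gamma \<alpha> / ((real n - 1) * rising (real n - 1) (\<alpha> - 1)) \<and>
           nabla_ML (- lam) \<alpha> 0 (real n) 0
             + lam * nabla_ML (- lam) \<alpha> (\<alpha> - 1) (real n) 0 = 0)"
proof (rule notI, elim exE conjE)
  fix lam :: real
  assume lam: "\<bar>lam\<bar> < Gamma \<alpha> / ((real n - 1) * rising (real n - 1) (\<alpha> - 1))"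
    and zero: "nabla_ML (- lam) \<alpha> 0 (real n) 0 + lam * nabla_ML (- lam) \<alpha> (\<alpha> - 1) (real n) 0 = 0"
  obtain m where n: "n = m + 2"
    using assms(3) by (metis le_Suc_ex add.commute)
  have \<alpha>: "0 < \<alpha>" using assms(1) by simp
  have "real n - 1 = real (Suc m)" using n by simp
  then have "\<bar>lam\<bar> < Gamma \<alpha> / (real (Suc m) * rising (real (Suc m)) (\<alpha> - 1))"
    using lam by (simp only:)
  \<comment> \<open>The product of the bound and the coefficient may equal 1, so strictness must
    come from the assumption on \<open>lam\<close>.\<close>
  then have "\<bar>lam\<bar> * ml_coeff \<alpha> m 1
      < Gamma \<alpha> / (real (Suc m) * rising (real (Suc m)) (\<alpha> - 1)) * ml_coeff \<alpha> m 1"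
    using ml_coeff_pos [OF \<alpha>] by (rule mult_strict_right_mono)
  with bound_mult_ml_coeff_1_le [OF assms(1), of m] have small: "\<bar>lam\<bar> * ml_coeff \<alpha> m 1 < 1"
    by linarith
  have "0 < (\<Sum>k. (- lam) ^ k * ml_coeff \<alpha> m k)"
    using small by (intro suminf_ml_coeff_pos \<alpha>) simp
  with zero nabla_ML_combination [OF \<alpha> small] show False
    by (simp only: n)
qed

end
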